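(* Every D3-reducible graph is 3-vertex-connected.
   Context: All graphs are finite and simple. The D3 reductions are the following two operations on a graph $G$. (D3a) Let $p,q,r$ be three vertices of degree three that induce a triangle in $G$ and whose neighbors outside $\{p,q,r\}$ are three distinct vertices; replace $p,q,r$ by a single new vertex adjacent to exactly those three outside neighbors. (D3b) Let $p,q,r$ be three vertices of degree three that induce a path with middle vertex $q$, and suppose there is a single vertex $s$ adjacent to all three of $p,q,r$; delete $q$ and add a new edge from $p$ to $r$. A graph is D3-reducible if it can be transformed into a graph isomorphic to $K_4$ by a finite sequence of D3 reductions. *)

theory Defs
  imports "Graph_Theory.Graph_Theory"
begin

text \<open>
  A finite simple graph is a \<^locale>\<open>pair_graph\<close>: a finite, loop-free, symmetric digraph whose arcs
  are pairs of vertices, an edge being represented by its two opposite arcs. Accordingly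
  \<^const>\<open>out_degree\<close> is the degree. For such graphs the arcs in the premises of both rules force all
  vertices involved to lie in \<open>pverts G\<close>, and in rule \<open>D3b\<close> force \<open>s\<close> to differ from \<open>p\<close>, \<open>q\<close>, \<open>r\<close>.

  In rule \<open>D3a\<close> the name \<open>x\<close> of the new vertex need only avoid the vertices that are kept; it may be
  one of the deleted names \<open>p\<close>, \<open>q\<close>, \<open>r\<close>, so that the reduction is also available when the
  vertices of \<open>G\<close> exhaust the type. Since \<open>p\<close>, \<open>q\<close>, \<open>r\<close> have degree three and span a triangle,
  \<open>p'\<close>, \<open>q'\<close>, \<open>r'\<close> are their only outside neighbours.
\<close>

inductive d3_reduction :: "'a pair_pre_digraph \<Rightarrow> 'a pair_pre_digraph \<Rightarrow> bool" where
  D3a: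
  "\<lbrakk> distinct [p, q, r];
     (p, q) \<in> parcs G; (q, r) \<in> parcs G; (p, r) \<in> parcs G;
     out_degree (with_proj G) p = 3; out_degree (with_proj G) q = 3; out_degree (with_proj G) r = 3;
     (p, p') \<in> parcs G; (q, q') \<in> parcs G; (r, r') \<in> parcs G;
     {p', q', r'} \<inter> {p, q, r} = {}; distinct [p', q', r'];
     x \<notin> pverts G - {p, q, r} \<rbrakk>
   \<Longrightarrow> d3_reduction G
        \<lparr> pverts = insert x (pverts G - {p, q, r}),
          parcs = {(u, v) \<in> parcs G. u \<notin> {p, q, r} \<and> v \<notin> {p, q, r}}
            \<union> {(x, p'), (p', x), (x, q'), (q', x), (x, r'), (r', x)} \<rparr>"
| D3b:
  "\<lbrakk> distinct [p, q, r];
     (p, q) \<in> parcs G; (q, r) \<in> parcs G; (p, r) \<notin> parcs G;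
     out_degree (with_proj G) p = 3; out_degree (with_proj G) q = 3; out_degree (with_proj G) r = 3;
     (s, p) \<in> parcs G; (s, q) \<in> parcs G; (s, r) \<in> parcs G \<rbrakk>
   \<Longrightarrow> d3_reduction G
        \<lparr> pverts = pverts G - {q},
          parcs = {(u, v) \<in> parcs G. u \<noteq> q \<and> v \<noteq> q} \<union> {(p, r), (r, p)} \<rparr>"

text \<open>
  \<^const>\<open>complete_digraph\<close> is a property of graphs that is invariant under isomorphism: it holds of
  exactly the graphs isomorphic to the complete graph on the given number of vertices.
\<close>

definition d3_reducible :: "'a pair_pre_digraph \<Rightarrow> bool" where
  "d3_reducible G \<longleftrightarrow> (\<exists>H. d3_reduction\<^sup>*\<^sup>* G H \<and> K\<^bsub>4\<^esub> (with_proj H))"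

definition vertex_connected :: "nat \<Rightarrow> ('a, 'b) pre_digraph \<Rightarrow> bool" where
  "vertex_connected k G \<longleftrightarrow>
     card (verts G) > k \<and> (\<forall>S \<subseteq> verts G. card S < k \<longrightarrow> connected (G \<restriction> (verts G - S)))"

end

theory Submission
  imports Defs
begin

text \<open>
  Being 3-connected means having no separation \<open>(A, B)\<close> in which fewer than three vertices lie outside
  \<open>A\<close> and \<open>B\<close>. Any such separation of a graph survives a D3 reduction: a triangle or a path that lies
  partly in the separator is handled by moving one vertex between a side and the separator, and the
  side cannot become empty, since otherwise the separator would contain three vertices or (in
  \<open>D3b\<close>) the reduced graph would have only three. Hence 3-connectivity lifts from \<open>K\<^sub>4\<close> back along
  the reductions.
\<close>

section \<open>Separations and vertex connectivity\<close>

definition separation :: "nat \<Rightarrow> 'a pair_pre_digraph \<Rightarrow> 'a set \<Rightarrow> 'a set \<Rightarrow> bool" where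
  "separation k G A B \<longleftrightarrow> A \<subseteq> pverts G \<and> B \<subseteq> pverts G \<and> A \<inter> B = {} \<and> A \<noteq> {} \<and> B \<noteq> {} \<and>
     (\<forall>a\<in>A. \<forall>b\<in>B. (a, b) \<notin> parcs G) \<and> card (pverts G - A - B) < k"

text \<open>The size bound is carried along because a small graph may lack separations for trivial
  reasons; in \<open>D3b\<close> it excludes a reduced graph on three vertices.\<close>

definition inseparable :: "nat \<Rightarrow> 'a pair_pre_digraph \<Rightarrow> bool" where
  "inseparable k G \<longleftrightarrow> k < card (pverts G) \<and> (\<forall>A B. \<not> separation k G A B)"

lemma separation_commute:
  assumes "sym (parcs G)"
  shows "separation k G A B \<longleftrightarrow> separation k G B A"
proof -
  have "pverts G - A - B = pverts G - B - A" by blast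
  then show ?thesis
    using assms unfolding separation_def by (auto dest: symD)
qed

lemma pair_graph_iff:
  "pair_graph G \<longleftrightarrow> finite (pverts G) \<and> parcs G \<subseteq> pverts G \<times> pverts G \<and> irrefl (parcs G) \<and> sym (parcs G)"
proof
  assume "pair_graph G"
  then interpret pair_graph G .
  show "finite (pverts G) \<and> parcs G \<subseteq> pverts G \<times> pverts G \<and> irrefl (parcs G) \<and> sym (parcs G)"
    using pair_finite_verts pair_sym_arcs no_loops'
    by (auto simp: irrefl_def symmetric_def intro: wellformed')
next
  assume *: "finite (pverts G) \<and> parcs G \<subseteq> pverts G \<times> pverts G \<and> irrefl (parcs G) \<and> sym (parcs G)"
  then have "finite (parcs G)"
    using finite_subset by blast
  with * show "pair_graph G"
    by unfold_locales (auto simp: irrefl_def symmetric_def)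
qed

text \<open>If removing \<open>S\<close> left some \<open>v\<close> unreachable from
  \<open>u\<close>, the vertices reachable from \<open>u\<close> and the other remaining ones would
  be the sides of a separation whose separator is exactly \<open>S\<close>.\<close>

lemma inseparable_imp_vertex_connected:
  assumes "pair_graph G" and "inseparable k G"
  shows "vertex_connected k (with_proj G)"
  unfolding vertex_connected_def
proof (intro conjI allI impI)
  interpret pair_graph G by fact
  show "k < card (verts (with_proj G))"
    using assms(2) by (simp add: inseparable_def)
  fix S assume S: "S \<subseteq> verts (with_proj G)" "card S < k"
  define W where "W = pverts G - S"
  define H where "H = with_proj G \<restriction> W"
  interpret H: wf_digraph H
    unfolding H_def by (rule wellformed_induce_subgraph)
  have arcs_H: "arcs_ends H = {(u, v) \<in> parcs G. u \<in> W \<and> v \<in> W}"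
    by (force simp: H_def arcs_ends_conv)
  have verts_H: "verts H = W"
    by (simp add: H_def)
  have "strongly_connected H"
  proof
    \<comment> \<open>Strong connectedness includes nonemptiness: fewer than \<open>k\<close>
      vertices cannot exhaust the graph.\<close>
    show "verts H \<noteq> {}"
    proof
      assume "verts H = {}"
      then have "pverts G = S" using S(1) by (auto simp: verts_H W_def)
      then show False using S(2) assms(2) by (simp add: inseparable_def)
    qed
    fix u v assume u: "u \<in> verts H" and v: "v \<in> verts H"
    define A where "A = {w. u \<rightarrow>\<^sup>*\<^bsub>H\<^esub> w}"
    have A: "A \<subseteq> W" "u \<in> A"
      using u H.reachable_in_verts(2) by (auto simp: A_def verts_H)
    have "(a, b) \<notin> parcs G" if "a \<in> A" "b \<in> W - A" for a b
      using that A(1) H.reachable_adj_trans[of u a b] by (auto simp: A_def arcs_H)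
    moreover have "pverts G - A - (W - A) = S"
      using S(1) A(1) by (auto simp: W_def)
    moreover have "W \<subseteq> pverts G"
      by (auto simp: W_def)
    ultimately have "separation k G A (W - A)" if "v \<notin> A"
      using that A S(2) v unfolding separation_def verts_H by auto
    then have "v \<in> A" using assms(2) by (auto simp: inseparable_def)
    then show "u \<rightarrow>\<^sup>*\<^bsub>H\<^esub> v" by (simp add: A_def)
  qed
  then have "connected H"
    using H.reachable_mk_symmetricI by (auto simp: connected_def strongly_connected_def)
  then show "connected (with_proj G \<restriction> (verts (with_proj G) - S))"
    by (simp add: H_def W_def)
qed

lemma complete_inseparable:
  assumes "K\<^bsub>n\<^esub> (with_proj G)" and "k < n"
  shows "inseparable k G"
  using assms by (fastforce simp: complete_digraph_pair_def inseparable_def separation_def)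

section \<open>Separations under a single reduction\<close>

lemma d3_reduction_pair_graph:
  assumes "d3_reduction G H" and "pair_graph G"
  shows "pair_graph H"
proof -
  have G: "finite (pverts G)" "parcs G \<subseteq> pverts G \<times> pverts G" "irrefl (parcs G)" "sym (parcs G)"
    using assms(2) by (auto simp: pair_graph_iff)
  from assms(1) show ?thesis
  proof cases
    case (D3a p q r p' q' r' x)
    have "{p', q', r'} \<subseteq> pverts G - {p, q, r}"
      using D3a G(2) by blast
    \<comment> \<open>The new arcs at \<open>x\<close> are no loops: their other ends are kept
      vertices, which \<open>x\<close> avoids.\<close>
    moreover from this have "x \<notin> {p', q', r'}"
      using D3a(14) by blast
    moreover have "irrefl (parcs H)"
      unfolding D3a(1) using G(3) calculation(2) by (auto simp: irrefl_def)
    moreover have "sym (parcs H)"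
      unfolding D3a(1) using G(4) by (intro symI) (auto dest: symD)
    ultimately show ?thesis
      unfolding pair_graph_iff using G(1,2) by (auto simp: D3a(1))
  next
    case (D3b p q r s)
    have "{p, r} \<subseteq> pverts G - {q}" "p \<noteq> r"
      using D3b(2-4) G(2) by auto
    moreover have "irrefl (parcs H)"
      unfolding D3b(1) using G(3) calculation(2) by (auto simp: irrefl_def)
    moreover have "sym (parcs H)"
      unfolding D3b(1) using G(4) by (intro symI) (auto dest: symD)
    ultimately show ?thesis
      unfolding pair_graph_iff using G(1,2) by (auto simp: D3b(1))
  qed
qed

text \<open>The triangle is a clique, so it cannot meet both sides; by symmetry let \<open>B\<close>
  miss it. If it lies within \<open>A\<close>, then \<open>x\<close> takes its place in
  \<open>A\<close>. Otherwise one of its vertices lies in the separator, and \<open>x\<close> takes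
  the place of that vertex.\<close>

lemma D3a_separation:
  assumes G: "pair_graph G" and sep: "separation 3 G A B"
    and dist: "distinct [p, q, r]" "distinct [p', q', r']" "{p', q', r'} \<inter> {p, q, r} = {}"
    and arcs: "(p, q) \<in> parcs G" "(q, r) \<in> parcs G" "(p, r) \<in> parcs G"
      "(p, p') \<in> parcs G" "(q, q') \<in> parcs G" "(r, r') \<in> parcs G"
    and x: "x \<notin> pverts G - {p, q, r}"
    and verts_H: "pverts H = insert x (pverts G - {p, q, r})"
    and arcs_H: "parcs H = {(u, v) \<in> parcs G. u \<notin> {p, q, r} \<and> v \<notin> {p, q, r}}
            \<union> {(x, p'), (p', x), (x, q'), (q', x), (x, r'), (r', x)}"
  shows "\<exists>A B. separation 3 H A B"
proof -
  have G': "finite (pverts G)" "parcs G \<subseteq> pverts G \<times> pverts G" "sym (parcs G)"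
    using G by (auto simp: pair_graph_iff)
  have inV: "{p, q, r, p', q', r'} \<subseteq> pverts G"
    using arcs G'(2) by auto
  have *: "\<exists>A B. separation 3 H A B" if sep: "separation 3 G A B" and B: "B \<inter> {p, q, r} = {}" for A B
  proof (cases "{p, q, r} \<subseteq> A")
    case True
    have "separation 3 H (insert x (A - {p, q, r})) B"
    proof -
      have "pverts H - insert x (A - {p, q, r}) - B = pverts G - A - B"
        using x True by (auto simp: verts_H)
      moreover have "\<forall>a\<in>insert x (A - {p, q, r}). \<forall>b\<in>B. (a, b) \<notin> parcs H"
      proof (intro ballI)
        fix a b assume a: "a \<in> insert x (A - {p, q, r})" and b: "b \<in> B"
        have "b \<noteq> x"
          using sep B x b unfolding separation_def by blast
        moreover have "b \<notin> {p', q', r'}"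
          using sep True arcs(4-6) b unfolding separation_def by blast
        moreover have "(a, b) \<notin> parcs G" if "a \<noteq> x"
          using sep a b that unfolding separation_def by blast
        \<comment> \<open>If \<open>x\<close> reuses a triangle name, \<open>parcs H\<close> drops
          its old arcs; otherwise \<open>x\<close> lies outside \<open>G\<close> and has
          none.\<close>
        moreover have "(x, b) \<notin> parcs G" if "x \<notin> {p, q, r}"
          using x that G'(2) by blast
        ultimately show "(a, b) \<notin> parcs H"
          unfolding arcs_H by auto
      qed
      ultimately show ?thesis
        using sep B x unfolding separation_def verts_H by auto
    qed
    then show ?thesis by blast
  next
    case False
    let ?S = "pverts G - A - B"
    have S: "card ?S < 3" "finite ?S"
      using sep G'(1) by (auto simp: separation_def)
    have nonempty: "A - {p, q, r} \<noteq> {}"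
    proof
      assume A: "A - {p, q, r} = {}"
      \<comment> \<open>Each triangle vertex yields a separator vertex: itself if outside
        \<open>A\<close>, else its outside neighbour, which is not in \<open>B\<close> by adjacency
        and not in \<open>A\<close> by assumption. These three are distinct, too many for the
        separator.\<close>
      let ?X = "{if p \<in> A then p' else p, if q \<in> A then q' else q, if r \<in> A then r' else r}"
      have "?X \<subseteq> ?S"
        using A arcs sep B inV dist(3) unfolding separation_def by auto
      then have "card ?X \<le> card ?S"
        using S(2) by (rule card_mono[rotated])
      moreover have "card ?X = 3"
        using dist by auto
      ultimately show False using S(1) by simp
    qed
    have "separation 3 H (A - {p, q, r}) B"
    proof -
      obtain t where t: "t \<in> {p, q, r}" "t \<in> ?S"
        using False B inV by auto
      have "pverts H - (A - {p, q, r}) - B \<subseteq> insert x (?S - {t})"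
        using t by (auto simp: verts_H)
      then have "card (pverts H - (A - {p, q, r}) - B) \<le> card (insert x (?S - {t}))"
        using S(2) by (intro card_mono) auto
      also have "\<dots> \<le> Suc (card (?S - {t}))"
        using S(2) by (simp add: card_insert_if)
      also have "\<dots> = card ?S"
        using S(2) t(2) by (rule card_Suc_Diff1)
      finally have "card (pverts H - (A - {p, q, r}) - B) < 3"
        using S(1) by simp
      moreover have "\<forall>a\<in>A - {p, q, r}. \<forall>b\<in>B. (a, b) \<notin> parcs H"
      proof (intro ballI)
        fix a b assume a: "a \<in> A - {p, q, r}" and b: "b \<in> B"
        have "a \<noteq> x" "b \<noteq> x"
          using sep B x a b unfolding separation_def by blast+
        moreover have "(a, b) \<notin> parcs G"
          using sep a b unfolding separation_def by blast
        ultimately show "(a, b) \<notin> parcs H"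
          unfolding arcs_H by auto
      qed
      ultimately show ?thesis
        using sep B x nonempty unfolding separation_def verts_H by auto
    qed
    then show ?thesis by blast
  qed
  have "A \<inter> {p, q, r} = {} \<or> B \<inter> {p, q, r} = {}"
    using sep arcs G'(3) unfolding separation_def by (auto dest: symD)
  then show ?thesis
    using * sep separation_commute[OF G'(3)] by metis
qed

text \<open>Only the new edge can spoil a separation, and only if \<open>p\<close> and
  \<open>r\<close> lie on opposite sides. Then \<open>q\<close> and \<open>s\<close>, adjacent to
  both, are in the separator, and deleting \<open>q\<close> makes room there for \<open>p\<close> or
  \<open>r\<close>.\<close>

lemma D3b_separation:
  assumes G: "pair_graph G" and sep: "separation 3 G A B"
    and dist: "distinct [p, q, r]"
    and arcs: "(p, q) \<in> parcs G" "(q, r) \<in> parcs G"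
      "(s, p) \<in> parcs G" "(s, q) \<in> parcs G" "(s, r) \<in> parcs G"
    and verts_H: "pverts H = pverts G - {q}"
    and arcs_H: "parcs H = {(u, v) \<in> parcs G. u \<noteq> q \<and> v \<noteq> q} \<union> {(p, r), (r, p)}"
    and card_H: "3 < card (pverts H)"
  shows "\<exists>A B. separation 3 H A B"
proof -
  have G': "finite (pverts G)" "parcs G \<subseteq> pverts G \<times> pverts G" "sym (parcs G)" "irrefl (parcs G)"
    using G by (auto simp: pair_graph_iff)
  have inV: "p \<in> pverts G" "q \<in> pverts G" "r \<in> pverts G" "s \<in> pverts G"
    using arcs G'(2) by auto
  have s: "s \<noteq> p" "s \<noteq> q" "s \<noteq> r"
    using arcs G'(4) by (auto simp: irrefl_def)
  have arcs': "(q, p) \<in> parcs G" "(r, q) \<in> parcs G"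
      "(p, s) \<in> parcs G" "(q, s) \<in> parcs G" "(r, s) \<in> parcs G"
    using arcs G'(3) by (auto dest: symD)
  \<comment> \<open>The neighbours \<open>p\<close>, \<open>r\<close>, \<open>s\<close> of
    \<open>q\<close> avoid \<open>B\<close>, so the new edge does not cross. If \<open>q\<close>
    were alone in \<open>A\<close>, all three would be in the separator.\<close>
  have in_A: "\<exists>A B. separation 3 H A B" if sep: "separation 3 G A B" and q: "q \<in> A" for A B
  proof -
    let ?S = "pverts G - A - B"
    have S: "card ?S < 3" "finite ?S"
      using sep G'(1) by (auto simp: separation_def)
    have B: "p \<notin> B" "r \<notin> B" "s \<notin> B" "q \<notin> B"
      using sep q arcs' arcs unfolding separation_def by auto
    have "A \<noteq> {q}"
    proof
      assume "A = {q}"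
      then have "{p, r, s} \<subseteq> ?S"
        using B dist s inV by auto
      then have "card {p, r, s} \<le> card ?S"
        using S(2) by (rule card_mono[rotated])
      then show False using S(1) dist s by auto
    qed
    moreover have "pverts H - (A - {q}) - B = ?S"
      using q by (auto simp: verts_H)
    ultimately have "separation 3 H (A - {q}) B"
      using sep q B unfolding separation_def verts_H arcs_H by auto
    then show ?thesis by blast
  qed
  have opposite: "\<exists>A B. separation 3 H A B"
    if sep: "separation 3 G A B" and q: "q \<notin> A" "q \<notin> B" and "p \<in> A" "r \<in> B" for A B
  proof -
    let ?S = "pverts G - A - B"
    have S: "card ?S < 3" "finite ?S"
      using sep G'(1) by (auto simp: separation_def)
    have s': "s \<notin> A" "s \<notin> B"
      using sep that arcs' arcs unfolding separation_def by auto
    have card_S: "card (insert t (?S - {q})) < 3" for t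
    proof -
      have "card (insert t (?S - {q})) \<le> Suc (card (?S - {q}))"
        using S(2) by (simp add: card_insert_if)
      also have "\<dots> = card ?S"
        using S(2) q inV by (intro card_Suc_Diff1) auto
      finally show ?thesis using S(1) by simp
    qed
    show ?thesis
    \<comment> \<open>Moving \<open>p\<close> into the separator must leave \<open>A\<close>
      nonempty; if it does not, \<open>r\<close> is moved out of \<open>B\<close> instead.\<close>
    proof (cases "A = {p}")
      case False
      have "pverts H - (A - {p}) - B = insert p (?S - {q})"
        using that sep inV dist by (auto simp: verts_H separation_def)
      then have "separation 3 H (A - {p}) B"
        using sep q that False card_S unfolding separation_def verts_H arcs_H by auto
      then show ?thesis by blast
    next
      case True
      \<comment> \<open>With both sides singletons, \<open>q\<close> and \<open>s\<close> fill the
        separator, so \<open>H\<close> has only the vertices \<open>p\<close>, \<open>r\<close>,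
        \<open>s\<close>, against \<open>card_H\<close>.\<close>
      have "B \<noteq> {r}"
      proof
        assume "B = {r}"
        have "{q, s} \<subseteq> ?S"
          using q s' inV by auto
        moreover have "card {q, s} = 2"
          using s by simp
        ultimately have "?S = {q, s}"
          using S by (intro card_seteq[symmetric]) auto
        then have "pverts H \<subseteq> {p, r, s}"
          using True \<open>B = {r}\<close> by (auto simp: verts_H)
        then have "card (pverts H) \<le> card {p, r, s}"
          by (rule card_mono[rotated]) simp
        then show False
          using card_H dist s by auto
      qed
      moreover have "pverts H - A - (B - {r}) = insert r (?S - {q})"
        using that sep inV dist by (auto simp: verts_H separation_def)
      ultimately have "separation 3 H A (B - {r})"
        using sep q that card_S unfolding separation_def verts_H arcs_H by auto
      then show ?thesis by blast
    qed
  qed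
  have commute: "separation 3 G B A"
    using sep separation_commute[OF G'(3)] by blast
  consider "q \<in> A" | "q \<in> B"
    | "q \<notin> A" "q \<notin> B" "p \<in> A" "r \<in> B"
    | "q \<notin> A" "q \<notin> B" "p \<in> B" "r \<in> A"
    | "q \<notin> A" "q \<notin> B" "\<not> (p \<in> A \<and> r \<in> B)" "\<not> (p \<in> B \<and> r \<in> A)"
    by blast
  then show ?thesis
  proof cases
    case 1
    then show ?thesis using in_A sep by blast
  next
    case 2
    then show ?thesis using in_A commute by blast
  next
    case 3
    then show ?thesis using opposite sep by blast
  next
    case 4
    then show ?thesis using opposite commute by blast
  next
    case 5
    \<comment> \<open>Here \<open>q\<close> is in the separator and the new edge does not join the
      sides, so the same sides work and the separator merely loses \<open>q\<close>.\<close>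
    have "card (pverts H - A - B) \<le> card (pverts G - A - B)"
      using G'(1) by (intro card_mono) (auto simp: verts_H)
    then have "separation 3 H A B"
      using sep 5 unfolding separation_def verts_H arcs_H by auto
    then show ?thesis by blast
  qed
qed

section \<open>Lifting back along the reductions\<close>

lemma d3_reduction_inseparable:
  assumes "d3_reduction G H" and "pair_graph G" and "inseparable 3 H"
  shows "inseparable 3 G"
  unfolding inseparable_def
proof (intro conjI allI notI)
  have fin: "finite (pverts G)" and wf: "parcs G \<subseteq> pverts G \<times> pverts G"
    using assms(2) by (auto simp: pair_graph_iff)
  have H: "3 < card (pverts H)" "\<And>A B. \<not> separation 3 H A B"
    using assms(3) by (auto simp: inseparable_def)
  show "3 < card (pverts G)"
    using assms(1)
  proof cases
    case (D3a p q r p' q' r' x)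
    \<comment> \<open>The added vertex \<open>x\<close> is offset by the deleted \<open>p\<close>,
      so the reduction does not increase the number of vertices.\<close>
    have "card (insert x (pverts G - {p, q, r})) \<le> Suc (card (pverts G - {p, q, r}))"
      using fin by (simp add: card_insert_if)
    also have "\<dots> \<le> Suc (card (pverts G - {p}))"
      using fin by (auto intro: card_mono)
    also have "\<dots> = card (pverts G)"
      using fin wf D3a(3) by (intro card_Suc_Diff1) auto
    finally show ?thesis using H(1) D3a by simp
  next
    case (D3b p q r s)
    then show ?thesis
      using H(1) card_mono[OF fin, of "pverts G - {q}"] by auto
  qed
  fix A B assume sep: "separation 3 G A B"
  show False
    using assms(1)
  proof cases
    case (D3a p q r p' q' r' x)
    have "\<exists>A B. separation 3 H A B"
      by (rule D3a_separation[OF assms(2) sep, of p q r p' q' r' x]) (use D3a in simp_all)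
    then show ?thesis using H(2) by blast
  next
    case (D3b p q r s)
    have "\<exists>A B. separation 3 H A B"
      by (rule D3b_separation[OF assms(2) sep, of p q r s]) (use D3b H(1) in simp_all)
    then show ?thesis using H(2) by blast
  qed
qed

theorem theorem5:
  fixes G :: "'a pair_pre_digraph"
  assumes "pair_graph G"
    and "d3_reducible G"
  shows "vertex_connected 3 (with_proj G)"
proof -
  obtain H where "d3_reduction\<^sup>*\<^sup>* G H" and K4: "K\<^bsub>4\<^esub> (with_proj H)"
    using assms(2) by (auto simp: d3_reducible_def)
  \<comment> \<open>\<open>pair_graph\<close> stays a premise inside the induction: it passes
    forward from a graph to its reduct, whereas inseparability passes backward from the final
    complete graph.\<close>
  then have "pair_graph G \<Longrightarrow> inseparable 3 G"
  proof (induction rule: converse_rtranclp_induct)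
    case base
    show ?case using complete_inseparable[OF K4] by simp
  next
    case (step G G')
    then show ?case
      using d3_reduction_pair_graph d3_reduction_inseparable by blast
  qed
  then show ?thesis
    using assms(1) inseparable_imp_vertex_connected by blast
qed

end
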